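(* Let $k\ge 2$ be an integer, let $\omega\in\mathbb{R}$ be irrational, and let $\lambda\in\mathbb{C}$ with $0<|\lambda|<1$. Let $\mu$ be the probability measure on the unit circle $\partial\mathbb{D}$ whose Verblunsky coefficients are $$\alpha_n=\lambda e^{2\pi i\,\omega n^k},\qquad n=0,1,2,\dots$$ Then $\operatorname{supp}(\mu)=\partial\mathbb{D}$.
   Context: $\mathbb{D}=\{z\in\mathbb{C}:|z|<1\}$. Given a sequence $\alpha_n\in\mathbb{D}$, $n\ge 0$ (Verblunsky coefficients), define monic polynomials by $\Phi_0(z)=1$, $\Phi_{n+1}(z)=z\Phi_n(z)-\overline{\alpha_n}\,\Phi_n^*(z)$, where $\Phi_n^*(z)=z^n\overline{\Phi_n(\overline{z}^{-1})}$. By Verblunsky's theorem there is a unique probability measure $\mu$ on $\partial\mathbb{D}$ with respect to which the $\Phi_n$ are orthogonal; $\mu$ is called the measure with Verblunsky coefficients $(\alpha_n)$. $\operatorname{supp}$ denotes the topological (closed) support. *)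

theory Defs
  imports "HOL-Probability.Probability" "HOL-Computational_Algebra.Polynomial"
begin

text \<open>The reversal of a polynomial of degree at most \<open>n\<close> with respect to the formal degree \<open>n\<close>:
  \<open>p\<^sup>*(z) = z\<^sup>n * cnj (p (1 / cnj z))\<close>, given by its coefficients so that it is a polynomial
  (in particular, it also has the right value at \<open>0\<close>).\<close>

definition reversed_poly :: "nat \<Rightarrow> complex poly \<Rightarrow> complex poly" where
  "reversed_poly n p = (\<Sum>i\<le>n. monom (cnj (coeff p (n - i))) i)"

lemma poly_reversed_poly:
  assumes "degree p \<le> n" and "z \<noteq> 0"
  shows "poly (reversed_poly n p) z = z ^ n * cnj (poly p (inverse (cnj z)))"
proof -
  have "poly p (inverse (cnj z)) = (\<Sum>i\<le>n. coeff p i * inverse (cnj z) ^ i)"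
    by (subst poly_as_sum_of_monoms'[OF assms(1), symmetric]) (simp add: poly_sum poly_monom)
  then have "z ^ n * cnj (poly p (inverse (cnj z)))
      = (\<Sum>i\<le>n. z ^ n * (cnj (coeff p i) * inverse z ^ i))"
    by (simp add: sum_distrib_left)
  also have "\<dots> = (\<Sum>i\<le>n. cnj (coeff p i) * z ^ (n - i))"
    using assms(2) by (intro sum.cong) (auto simp: power_diff field_simps)
  also have "\<dots> = (\<Sum>i\<le>n. cnj (coeff p (n - i)) * z ^ i)"
    by (rule sum.reindex_bij_witness[where i = "\<lambda>i. n - i" and j = "\<lambda>i. n - i"]) auto
  also have "\<dots> = poly (reversed_poly n p) z"
    by (simp add: reversed_poly_def poly_sum poly_monom)
  finally show ?thesis by simp
qed

fun szego_poly :: "(nat \<Rightarrow> complex) \<Rightarrow> nat \<Rightarrow> complex poly" where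
  "szego_poly \<alpha> 0 = 1"
| "szego_poly \<alpha> (Suc n) =
     monom 1 1 * szego_poly \<alpha> n - smult (cnj (\<alpha> n)) (reversed_poly n (szego_poly \<alpha> n))"

lemma degree_reversed_poly: "degree (reversed_poly n p) \<le> n"
  unfolding reversed_poly_def
  by (intro degree_sum_le) (auto intro: order.trans[OF degree_monom_le])

lemma szego_poly_monic: "degree (szego_poly \<alpha> n) = n \<and> lead_coeff (szego_poly \<alpha> n) = 1"
proof (induction n)
  case (Suc n)
  let ?p = "szego_poly \<alpha> n" and ?q = "smult (cnj (\<alpha> n)) (reversed_poly n (szego_poly \<alpha> n))"
  have q: "degree ?q \<le> n"
    using degree_reversed_poly degree_smult_le order.trans by blast
  have "?p \<noteq> 0" using Suc by auto
  then have d: "degree (monom 1 1 * ?p) = Suc n"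
    using Suc by (simp add: degree_mult_eq degree_monom_eq)
  have "coeff ?p n = 1" using Suc by metis
  then have c: "coeff (szego_poly \<alpha> (Suc n)) (Suc n) = 1"
    using degree_reversed_poly[of n ?p]
    by (simp add: coeff_monom_mult coeff_eq_0[of "reversed_poly n ?p" "Suc n"])
  have "degree (szego_poly \<alpha> (Suc n)) \<le> Suc n"
    using d q by (auto intro!: degree_diff_le)
  then have "degree (szego_poly \<alpha> (Suc n)) = Suc n"
    using c by (metis le_antisym le_degree zero_neq_one)
  with c show ?case by simp
qed simp

text \<open>For \<open>\<alpha>\<close> with values in the open unit disc there is exactly one such measure
  (Verblunsky's theorem).\<close>

definition has_verblunsky_coeffs :: "complex measure \<Rightarrow> (nat \<Rightarrow> complex) \<Rightarrow> bool" where
  "has_verblunsky_coeffs M \<alpha> \<longleftrightarrow>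
     (\<forall>n. \<alpha> n \<in> ball 0 1) \<and>
     prob_space M \<and>
     sets M = sets (restrict_space borel (sphere 0 1)) \<and>
     (\<forall>m n. m \<noteq> n \<longrightarrow>
        (LINT z|M. poly (szego_poly \<alpha> m) z * cnj (poly (szego_poly \<alpha> n) z)) = 0)"

text \<open>Intersecting with \<open>space M\<close> makes this the support in the ambient topological space of a
  Borel measure that lives on a subspace.\<close>

definition measure_support :: "'a::topological_space measure \<Rightarrow> 'a set" where
  "measure_support M = {x. \<forall>U. open U \<and> x \<in> U \<longrightarrow> emeasure M (U \<inter> space M) \<noteq> 0}"

end

theory Submission
  imports Defs "HOL-Real_Asymp.Real_Asymp"
begin

text \<open>Write \<open>c\<^sub>s(M)\<close> for the Fourier coefficients of the probability measure
  \<open>|\<Phi>\<^sub>M|\<^sup>2 d\<mu> / \<parallel>\<Phi>\<^sub>M\<parallel>\<^sup>2\<close>. By the Szego recursion, \<open>c\<^sub>s(M)\<close> is a polynomial in the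
  coefficients \<open>\<alpha>\<^sub>n\<close>, \<open>cnj \<alpha>\<^sub>n\<close> with \<open>n\<close> near \<open>M\<close>, and it is multiplied by \<open>exp (- \<i> s \<beta>)\<close> under the
  gauge transformation \<open>\<alpha>\<^sub>n \<mapsto> exp (\<i> (n \<beta> + \<gamma>)) \<alpha>\<^sub>n\<close>. For \<open>\<alpha>\<^sub>n = l exp (2 \<pi> \<i> \<omega> n\<^sup>k)\<close> this forces
  every monomial to be \<open>exp (2 \<pi> \<i> \<omega> Q(M))\<close> with \<open>Q\<close> of degree \<open>k - 1\<close> and leading coefficient
  \<open>- k s\<close>, so by Weyl's theorem \<open>c\<^sub>s(M)\<close> has mean zero over \<open>M\<close> for \<open>s \<noteq> 0\<close>. Hence the integrals of
  the Fejer kernel \<open>|\<Sum>s<L. (z / w)\<^sup>s|\<^sup>2\<close> against these measures have mean \<open>L\<close>, which for large \<open>L\<close>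
  is impossible if \<open>\<mu>\<close> gives no mass to a neighbourhood of \<open>w\<close>, since off that neighbourhood the
  kernel is bounded independently of \<open>L\<close>.\<close>

section \<open>Weyl's theorem for polynomial phases\<close>

definition vanishing_mean :: "(nat \<Rightarrow> complex) \<Rightarrow> bool" where
  "vanishing_mean u \<longleftrightarrow> (\<lambda>N. (\<Sum>n<N. u n) / of_nat N) \<longlonglongrightarrow> 0"

lemma vanishing_mean_zero: "vanishing_mean (\<lambda>n. 0)"
  by (simp add: vanishing_mean_def)

lemma vanishing_mean_add:
  assumes "vanishing_mean u" "vanishing_mean v"
  shows "vanishing_mean (\<lambda>n. u n + v n)"
  using tendsto_add[OF assms[unfolded vanishing_mean_def]]
  by (simp add: vanishing_mean_def sum.distrib add_divide_distrib)

lemma vanishing_mean_cmult: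
  assumes "vanishing_mean u"
  shows "vanishing_mean (\<lambda>n. c * u n)"
  using tendsto_mult_left[OF assms[unfolded vanishing_mean_def], of c]
  by (simp add: vanishing_mean_def sum_distrib_left)

lemma vanishing_mean_cnj:
  assumes "vanishing_mean u"
  shows "vanishing_mean (\<lambda>n. cnj (u n))"
  using tendsto_cnj[OF assms[unfolded vanishing_mean_def]]
  by (simp add: vanishing_mean_def)

text \<open>Each unit shift changes the sum only by its two end terms.\<close>

lemma norm_sum_shift_diff_le:
  fixes u :: "nat \<Rightarrow> complex"
  assumes "\<And>n. norm (u n) \<le> 1"
  shows "norm ((\<Sum>n<N. u (n + h)) - (\<Sum>n<N. u n)) \<le> 2 * real h"
proof (induction h)
  case (Suc h)
  have "(\<Sum>n<N. u (n + Suc h)) - (\<Sum>n<N. u (n + h)) = u (N + h) - u h"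
    using sum_lessThan_telescope[of "\<lambda>n. u (n + h)" N]
    by (simp add: sum_subtractf)
  then have "norm ((\<Sum>n<N. u (n + Suc h)) - (\<Sum>n<N. u (n + h))) \<le> 2"
    using norm_triangle_ineq4[of "u (N + h)" "u h"] assms[of "N + h"] assms[of h] by simp
  then show ?case
    using Suc norm_triangle_ineq[of "(\<Sum>n<N. u (n + Suc h)) - (\<Sum>n<N. u (n + h))"
        "(\<Sum>n<N. u (n + h)) - (\<Sum>n<N. u n)"] by simp
qed simp

text \<open>Averaging \<open>u\<close> over \<open>H\<close> shifts changes its mean only by a
  boundary error. By Cauchy-Schwarz the averaged sequence is controlled by the \<open>H^2\<close>
  correlations, of which only the \<open>H\<close> diagonal ones persist, so the mean of
  \<open>u\<close> is eventually at most of order \<open>1 / sqrt H\<close>.\<close>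

lemma van_der_corput:
  fixes u :: "nat \<Rightarrow> complex"
  assumes u: "\<And>n. norm (u n) \<le> 1"
    and corr: "\<And>h h'. h \<noteq> h' \<Longrightarrow> vanishing_mean (\<lambda>n. u (n + h) * cnj (u (n + h')))"
  shows "vanishing_mean u"
  unfolding vanishing_mean_def tendsto_iff dist_norm diff_0_right
proof (intro allI impI)
  fix e :: real
  assume e: "e > 0"
  \<comment> \<open>The 8 comes from the comparison \<open>2 * H * N^2 < (e / 2 * N * H)^2\<close>,
    which amounts to \<open>8 / e^2 < H\<close>. The other half of \<open>e\<close> pays for the
    shifts.\<close>
  obtain H :: nat where H: "H > 8 / e\<^sup>2"
    using reals_Archimedean2 by blast
  have "8 / e\<^sup>2 > 0" using e by simp
  with H have H0: "H > 0" by (cases H) auto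
  define D where "D h h' N = (\<Sum>n<N. u (n + h) * cnj (u (n + h'))) / of_nat N" for h h' N
  have off: "((\<lambda>N. norm (D h h' N)) \<longlonglongrightarrow> 0)" if "h \<noteq> h'" for h h'
    using corr[OF that] tendsto_norm_zero unfolding vanishing_mean_def D_def by blast
  have diag: "norm (D h h N) \<le> 1" for h N
  proof -
    have "norm (\<Sum>n<N. u (n + h) * cnj (u (n + h))) \<le> (\<Sum>n<N. 1)"
      by (rule sum_norm_le) (use u in \<open>simp add: norm_mult mult_le_one\<close>)
    then show ?thesis by (cases "N = 0") (simp_all add: D_def norm_divide divide_le_eq_1)
  qed
  \<comment> \<open>\<open>E\<close> bounds the double sum of correlations and tends to
    \<open>H\<close>, the number of diagonal terms, so it is eventually below
    \<open>2 * H\<close>.\<close>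
  define E where "E N = (\<Sum>h<H. \<Sum>h'<H. if h = h' then 1 else norm (D h h' N))" for N
  have "E \<longlonglongrightarrow> (\<Sum>h<H. \<Sum>h'<H. if h = h' then 1 else 0)"
    unfolding E_def by (intro tendsto_sum) (auto intro: off)
  then have "E \<longlonglongrightarrow> real H" by simp
  then have ev1: "\<forall>\<^sub>F N in sequentially. E N < real H + real H"
    using H0 by (intro order_tendstoD(2)) auto
  have "(\<lambda>N. 2 * real H / real N) \<longlonglongrightarrow> 0"
    by real_asymp
  then have ev2: "\<forall>\<^sub>F N in sequentially. 2 * real H / real N < e / 2"
    using e by (intro order_tendstoD(2)) auto
  show "\<forall>\<^sub>F N in sequentially. norm ((\<Sum>n<N. u n) / of_nat N) < e"
    using ev1 ev2 eventually_gt_at_top[of 0]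
  proof eventually_elim
    case (elim N)
    define S where "S n = (\<Sum>h<H. u (n + h))" for n
    have "(\<Sum>n<N. norm (S n))\<^sup>2 \<le> (\<Sum>n<N. (norm (S n))\<^sup>2) * (\<Sum>n<N. 1\<^sup>2)"
      using Cauchy_Schwarz_ineq_sum[of "\<lambda>n. norm (S n)" "\<lambda>n. 1" "{..<N}"] by simp
    then have 1: "(norm (\<Sum>n<N. S n))\<^sup>2 \<le> (\<Sum>n<N. (norm (S n))\<^sup>2) * real N"
      using power_mono[OF norm_sum[of S "{..<N}"], of 2] by simp
    have "complex_of_real (\<Sum>n<N. (norm (S n))\<^sup>2) = (\<Sum>n<N. S n * cnj (S n))"
      by (simp add: complex_norm_square del: of_real_power)
    also have "\<dots> = (\<Sum>n<N. \<Sum>h<H. \<Sum>h'<H. u (n + h) * cnj (u (n + h')))"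
      by (simp add: S_def sum_product)
    also have "\<dots> = (\<Sum>h<H. \<Sum>h'<H. \<Sum>n<N. u (n + h) * cnj (u (n + h')))"
      by (subst sum.swap, rule sum.cong[OF refl], subst sum.swap, rule refl)
    also have "\<dots> = of_nat N * (\<Sum>h<H. \<Sum>h'<H. D h h' N)"
      using elim by (simp add: D_def flip: sum_divide_distrib)
    finally have "norm (complex_of_real (\<Sum>n<N. (norm (S n))\<^sup>2))
        = real N * norm (\<Sum>h<H. \<Sum>h'<H. D h h' N)"
      by (simp only: norm_mult norm_of_nat)
    then have 2: "(\<Sum>n<N. (norm (S n))\<^sup>2) = real N * norm (\<Sum>h<H. \<Sum>h'<H. D h h' N)"
      unfolding norm_of_real by (simp add: sum_nonneg)
    have "norm (\<Sum>h<H. \<Sum>h'<H. D h h' N) \<le> E N"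
      unfolding E_def by (intro sum_norm_le) (use diag in auto)
    then have "norm (\<Sum>h<H. \<Sum>h'<H. D h h' N) \<le> 2 * real H"
      using elim by simp
    then have "(norm (\<Sum>n<N. S n))\<^sup>2 \<le> (real N * (2 * real H)) * real N"
      using 1 unfolding 2
      by (meson mult_left_mono mult_right_mono of_nat_0_le_iff order_trans)
    also have "\<dots> < (e / 2 * (real N * real H))\<^sup>2"
    proof -
      have "8 < e\<^sup>2 * real H" using H e by (simp add: field_simps)
      then have "2 * (real H * (real N)\<^sup>2) < (e\<^sup>2 * real H / 4) * (real H * (real N)\<^sup>2)"
        using H0 elim by (intro mult_strict_right_mono) auto
      then show ?thesis by (simp add: power2_eq_square algebra_simps)
    qed
    finally have 3: "norm (\<Sum>n<N. S n) < e / 2 * (real N * real H)"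
      by (rule power_less_imp_less_base) (use e in simp)
    \<comment> \<open>Replacing \<open>u\<close> by its shifts costs at most \<open>2 * H^2\<close>,
      which \<open>ev2\<close> makes smaller than \<open>e / 2 * (N * H)\<close>.\<close>
    have "of_nat H * (\<Sum>n<N. u n) - (\<Sum>n<N. S n)
        = (\<Sum>h<H. (\<Sum>n<N. u n) - (\<Sum>n<N. u (n + h)))"
      unfolding S_def by (subst sum.swap) (simp add: sum_subtractf)
    also have "norm \<dots> \<le> (\<Sum>h<H. 2 * real H)"
    proof (rule sum_norm_le)
      fix h assume "h \<in> {..<H}"
      then show "norm ((\<Sum>n<N. u n) - (\<Sum>n<N. u (n + h))) \<le> 2 * real H"
        using norm_sum_shift_diff_le[of u h N, OF u] by (simp add: norm_minus_commute)
    qed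
    also have "\<dots> = 2 * real H * real H" by simp
    also have "\<dots> < e / 2 * (real N * real H)"
      using elim H0 by (simp add: field_simps)
    finally have "norm (of_nat H * (\<Sum>n<N. u n)) < e * (real N * real H)"
      using 3 norm_triangle_sub[of "of_nat H * (\<Sum>n<N. u n)" "\<Sum>n<N. S n"] by simp
    then show ?case
      using H0 elim by (simp add: norm_mult norm_divide field_simps)
  qed
qed

text \<open>The top two coefficients of a Taylor shift serve twice: for the differencing in Weyl's
  theorem and for the phase of \<open>\<alpha> (j + p)\<close>.\<close>

lemma pcompose_shift_coeffs:
  fixes p :: "'a::comm_ring_1 poly"
  assumes "degree p \<le> Suc n"
  shows "degree (pcompose p [:h, 1:]) \<le> Suc n"
    and "coeff (pcompose p [:h, 1:]) (Suc n) = coeff p (Suc n)"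
    and "coeff (pcompose p [:h, 1:]) n = coeff p n + of_nat (Suc n) * h * coeff p (Suc n)"
proof -
  have "degree (pcompose p [:h, 1:]) \<le> Suc n
    \<and> coeff (pcompose p [:h, 1:]) (Suc n) = coeff p (Suc n)
    \<and> coeff (pcompose p [:h, 1:]) n = coeff p n + of_nat (Suc n) * h * coeff p (Suc n)"
    using assms
  proof (induction n arbitrary: p)
    case 0
    obtain a q where p: "p = pCons a q" by (cases p) auto
    with 0 have "degree q = 0" by (auto split: if_splits)
    then obtain b where "q = [:b:]" by (metis degree_eq_zeroE)
    then show ?case using p by (simp add: pcompose_pCons)
  next
    case (Suc n)
    obtain a q where p: "p = pCons a q" by (cases p) auto
    with Suc.prems have q: "degree q \<le> Suc n" by (auto split: if_splits)
    note IH = Suc.IH[OF q]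
    let ?c = "pcompose q [:h, 1:]"
    have eq: "pcompose p [:h, 1:] = pCons a 0 + (smult h ?c + pCons 0 ?c)"
      by (simp add: p pcompose_pCons)
    have "degree (pcompose p [:h, 1:]) \<le> Suc (Suc n)"
      unfolding eq using IH
      by (intro degree_add_le) (auto intro: order_trans[OF degree_smult_le] simp: degree_pCons_eq_if)
    moreover have "coeff ?c (Suc (Suc n)) = 0"
      using IH by (intro coeff_eq_0) auto
    ultimately show ?case
      using IH unfolding eq by (simp add: p algebra_simps)
  qed
  then show "degree (pcompose p [:h, 1:]) \<le> Suc n"
    "coeff (pcompose p [:h, 1:]) (Suc n) = coeff p (Suc n)"
    "coeff (pcompose p [:h, 1:]) n = coeff p n + of_nat (Suc n) * h * coeff p (Suc n)"
    by auto
qed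

text \<open>Differencing: \<open>p (x + h) - p (x + h')\<close> has its degree bound lowered by one,
  and its coefficient there is a nonzero integer multiple of the top coefficient of
  \<open>p\<close>, hence still irrational. The base case is a geometric sum with ratio different
  from 1.\<close>

lemma weyl_vanishing_mean:
  fixes p :: "real poly"
  assumes "degree p \<le> Suc d" "coeff p (Suc d) \<notin> \<rat>"
  shows "vanishing_mean (\<lambda>n. cis (2 * pi * poly p (real n)))"
  using assms
proof (induction d arbitrary: p)
  case 0
  obtain a q where p: "p = pCons a q" by (cases p) auto
  with 0 have "degree q = 0" by (auto split: if_splits)
  then obtain t where "q = [:t:]" by (metis degree_eq_zeroE)
  with p 0 have t: "p = [:a, t:]" "t \<notin> \<rat>" by auto
  define w where "w = cis (2 * pi * t)"
  have w: "w \<noteq> 1"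
  proof
    assume "w = 1"
    then obtain m :: int where "2 * pi * t = of_int m * (2 * pi)"
      unfolding w_def by (auto simp: complex_eq_iff cos_one_2pi_int)
    then have "t = of_int m" by simp
    with t(2) show False by simp
  qed
  have [simp]: "norm w = 1" by (simp add: w_def)
  have eq: "cis (2 * pi * poly p (real n)) = cis (2 * pi * a) * w ^ n" for n
    by (simp add: t(1) w_def Complex.DeMoivre cis_mult algebra_simps)
  have "(\<lambda>N. (\<Sum>n<N. w ^ n) / of_nat N) \<longlonglongrightarrow> 0"
  proof (rule Lim_null_comparison)
    have "norm ((\<Sum>n<N. w ^ n) / of_nat N) \<le> (2 / norm (w - 1)) / real N" for N
    proof -
      have "norm (w ^ N - 1) \<le> 2"
        using norm_triangle_ineq4[of "w ^ N" 1] by (simp add: norm_power)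
      then show ?thesis
        using w by (simp add: geometric_sum norm_divide norm_mult divide_right_mono)
    qed
    then show "\<forall>\<^sub>F N in sequentially. norm ((\<Sum>n<N. w ^ n) / of_nat N) \<le> (2 / norm (w - 1)) / real N"
      by simp
    show "(\<lambda>N. (2 / norm (w - 1)) / real N) \<longlonglongrightarrow> 0"
      by real_asymp
  qed
  then show ?case
    unfolding eq by (intro vanishing_mean_cmult) (simp add: vanishing_mean_def)
next
  case (Suc d)
  show ?case
  proof (rule van_der_corput)
    fix h h' :: nat
    assume "h \<noteq> h'"
    let ?s = "\<lambda>h. pcompose p [:real h, 1:]"
    let ?q = "?s h - ?s h'"
    note s = pcompose_shift_coeffs[OF Suc.prems(1)]
    have "degree ?q \<le> Suc (Suc d)" "coeff ?q (Suc (Suc d)) = 0"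
      using s by (auto intro: degree_diff_le)
    then have dq: "degree ?q \<le> Suc d"
      by (metis coeff_0 degree_0 le_Suc_eq leading_coeff_0_iff le0)
    have "coeff ?q (Suc d)
        = of_int (int (Suc (Suc d)) * (int h - int h')) * coeff p (Suc (Suc d))"
      by (simp add: s algebra_simps)
    moreover have "int (Suc (Suc d)) * (int h - int h') \<noteq> 0"
      using \<open>h \<noteq> h'\<close> by simp
    ultimately have "coeff ?q (Suc d) \<notin> \<rat>"
      using Suc.prems(2) by (metis Rats_divide Rats_of_int nonzero_mult_div_cancel_left of_int_eq_0_iff)
    then have "vanishing_mean (\<lambda>n. cis (2 * pi * poly ?q (real n)))"
      by (rule Suc.IH[OF dq])
    moreover have "cis (2 * pi * poly ?q (real n))
        = cis (2 * pi * poly p (real (n + h))) * cnj (cis (2 * pi * poly p (real (n + h'))))" for n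
      by (simp add: poly_pcompose cis_cnj cis_mult algebra_simps)
    ultimately show "vanishing_mean (\<lambda>n. cis (2 * pi * poly p (real (n + h)))
        * cnj (cis (2 * pi * poly p (real (n + h')))))"
      by simp
  qed simp
qed

section \<open>Polynomial phases graded by their two leading coefficients\<close>

text \<open>The gauge weight of a product of factors \<open>\<alpha> (j + p)\<close> and \<open>cnj (\<alpha> (j + p))\<close>: \<open>e\<close> is the signed
  number of factors and \<open>d\<close> the signed sum of the offsets \<open>p\<close>. With \<open>\<alpha> n = l exp (2 \<pi> \<i> \<omega> n\<^sup>k)\<close>, these
  are read off from the coefficients of degree \<open>k\<close> and \<open>k - 1\<close> of the phase as a polynomial in \<open>j\<close>.\<close>

inductive gauge_class :: "nat \<Rightarrow> real \<Rightarrow> real \<Rightarrow> real \<Rightarrow> (nat \<Rightarrow> complex) \<Rightarrow> bool"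
  for k \<omega> where
  zero: "gauge_class k \<omega> e d (\<lambda>j. 0)"
| phase: "degree q \<le> k \<Longrightarrow> coeff q k = e \<Longrightarrow> coeff q (k - 1) = k * d
    \<Longrightarrow> gauge_class k \<omega> e d (\<lambda>j. c * cis (2 * pi * \<omega> * poly q (real j)))"
| add: "gauge_class k \<omega> e d f \<Longrightarrow> gauge_class k \<omega> e d g \<Longrightarrow> gauge_class k \<omega> e d (\<lambda>j. f j + g j)"

lemma gauge_class_const: "gauge_class k \<omega> 0 0 (\<lambda>j. c)"
  using gauge_class.phase[of 0 k 0 0 \<omega> c] by simp

text \<open>Phases add under multiplication, and so do the weights. The case \<open>q = 0\<close>
  provides closure under scalar factors.\<close>

lemma gauge_class_mult_phase:
  assumes q: "degree q \<le> k" "coeff q k = e'" "coeff q (k - 1) = k * d'"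
    and f: "gauge_class k \<omega> e d f"
  shows "gauge_class k \<omega> (e + e') (d + d') (\<lambda>j. c * cis (2 * pi * \<omega> * poly q (real j)) * f j)"
  using f
proof induction
  case (zero e d)
  then show ?case by (simp add: gauge_class.zero)
next
  case (phase q' e d c')
  have eq: "c * cis (2 * pi * \<omega> * poly q (real j)) * (c' * cis (2 * pi * \<omega> * poly q' (real j)))
      = (c * c') * cis (2 * pi * \<omega> * poly (q' + q) (real j))" for j
    by (simp add: cis_mult[symmetric] algebra_simps)
  show ?case
    unfolding eq using phase q
    by (intro gauge_class.phase) (auto intro: degree_add_le simp: algebra_simps)
next
  case (add e d f g)
  then show ?case using gauge_class.add by (simp add: distrib_left)
qed

text \<open>Weight \<open>e = 0\<close> removes the term of degree \<open>k\<close>. The coefficient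
  of degree \<open>k - 1\<close> is then \<open>\<omega> * k * d\<close>, irrational because
  \<open>k * d\<close> is a nonzero rational, and Weyl's theorem applies since \<open>k - 1\<close>
  is at least 1.\<close>

lemma gauge_class_vanishing_mean:
  assumes "gauge_class k \<omega> e d f" "k \<ge> 2" "\<omega> \<notin> \<rat>" "e = 0" "d \<in> \<rat>" "d \<noteq> 0"
  shows "vanishing_mean f"
  using assms
proof induction
  case (phase q e d c)
  obtain m where m: "k = Suc (Suc m)"
    using \<open>k \<ge> 2\<close> by (metis add_2_eq_Suc le_Suc_ex)
  have "degree q \<le> Suc m"
    using phase m by (metis coeff_0 degree_0 le_Suc_eq leading_coeff_0_iff le0)
  then have "degree (smult \<omega> q) \<le> Suc m"
    using degree_smult_le order_trans by blast
  moreover have "\<omega> * (real k * d) \<notin> \<rat>"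
  proof
    assume "\<omega> * (real k * d) \<in> \<rat>"
    moreover have "real k * d \<in> \<rat>" "real k * d \<noteq> 0"
      using phase by auto
    ultimately have "\<omega> * (real k * d) / (real k * d) \<in> \<rat>"
      using Rats_divide by blast
    with \<open>real k * d \<noteq> 0\<close> \<open>\<omega> \<notin> \<rat>\<close> show False by simp
  qed
  then have "coeff (smult \<omega> q) (Suc m) \<notin> \<rat>"
    using phase m by simp
  ultimately have "vanishing_mean (\<lambda>n. cis (2 * pi * poly (smult \<omega> q) (real n)))"
    by (rule weyl_vanishing_mean)
  then show ?case
    by (intro vanishing_mean_cmult) (simp add: mult.assoc)
qed (auto intro: vanishing_mean_zero vanishing_mean_add)

text \<open>Since \<open>(x + p)^k = x^k + k p x^(k-1) + ...\<close>, the factor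
  \<open>\<alpha> (j + p)\<close> has weights 1 and \<open>p\<close>; conjugation negates the phase
  and with it both weights.\<close>

lemma gauge_class_mult_coeff:
  assumes k: "k \<ge> 1" and f: "gauge_class k \<omega> e d f"
  shows "gauge_class k \<omega> (e + 1) (d + real p)
      (\<lambda>j. l * cis (2 * pi * \<omega> * real (j + p) ^ k) * f j)"
    and "gauge_class k \<omega> (e - 1) (d - real p)
      (\<lambda>j. cnj (l * cis (2 * pi * \<omega> * real (j + p) ^ k)) * f j)"
proof -
  obtain m where m: "k = Suc m" using k by (cases k) auto
  let ?q = "pcompose (monom 1 k) [:real p, 1:]"
  have q: "degree ?q \<le> k" "coeff ?q k = 1" "coeff ?q (k - 1) = k * real p"
    using pcompose_shift_coeffs[of "monom 1 k" m "real p"] by (simp_all add: m degree_monom_le)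
  have pq: "poly ?q (real j) = real (j + p) ^ k" for j
    by (simp add: poly_pcompose poly_monom add.commute)
  show "gauge_class k \<omega> (e + 1) (d + real p)
      (\<lambda>j. l * cis (2 * pi * \<omega> * real (j + p) ^ k) * f j)"
    using gauge_class_mult_phase[OF q f, of l] by (simp only: pq)
  have q': "degree (- ?q) \<le> k" "coeff (- ?q) k = - 1" "coeff (- ?q) (k - 1) = k * (- real p)"
    using q by simp_all
  show "gauge_class k \<omega> (e - 1) (d - real p)
      (\<lambda>j. cnj (l * cis (2 * pi * \<omega> * real (j + p) ^ k)) * f j)"
    using gauge_class_mult_phase[OF q' f, of "cnj l"]
    by (simp only: pq poly_minus) (simp add: cis_cnj)
qed

section \<open>Local moments of orthogonal polynomials\<close>

locale verblunsky =
  fixes \<mu> :: "complex measure" and \<alpha> :: "nat \<Rightarrow> complex"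
  assumes verblunsky: "has_verblunsky_coeffs \<mu> \<alpha>"
begin

sublocale prob_space \<mu>
  using verblunsky by (simp add: has_verblunsky_coeffs_def)

lemma sets_eq: "sets \<mu> = sets (restrict_space borel (sphere 0 1))"
  using verblunsky by (simp add: has_verblunsky_coeffs_def)

lemma space_eq: "space \<mu> = sphere 0 1"
  using sets_eq_imp_space_eq[OF sets_eq] by (simp add: space_restrict_space)

lemma norm_space: "z \<in> space \<mu> \<Longrightarrow> norm z = 1"
  by (simp add: space_eq)

lemma cnj_space: "z \<in> space \<mu> \<Longrightarrow> z * cnj z = 1"
  using norm_space by (simp add: complex_norm_square[symmetric])

lemma integrable_continuous:
  fixes f :: "complex \<Rightarrow> complex"
  assumes "continuous_on UNIV f"
  shows "integrable \<mu> f"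
proof -
  have "f \<in> borel_measurable (restrict_space borel (sphere 0 1))"
    using assms by (intro measurable_restrict_space1 borel_measurable_continuous_onI)
  then have m: "f \<in> borel_measurable \<mu>"
    using measurable_cong_sets[OF sets_eq refl] by blast
  have "compact (f ` sphere 0 1)"
    using assms by (intro compact_continuous_image continuous_on_subset[OF assms]) auto
  then obtain B where "\<And>z. z \<in> sphere 0 1 \<Longrightarrow> norm (f z) \<le> B"
    by (meson bounded_iff compact_imp_bounded imageI)
  then show ?thesis
    using m by (intro integrable_const_bound[where B = B]) (auto simp: space_eq)
qed

section \<open>The inner product of L^2(\<mu>) and the Szego recursion\<close>

definition ip :: "(complex \<Rightarrow> complex) \<Rightarrow> (complex \<Rightarrow> complex) \<Rightarrow> complex" where
  "ip f g = (LINT z|\<mu>. f z * cnj (g z))"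

abbreviation phi :: "nat \<Rightarrow> complex \<Rightarrow> complex" where
  "phi n z \<equiv> poly (szego_poly \<alpha> n) z"

abbreviation phis :: "nat \<Rightarrow> complex \<Rightarrow> complex" where
  "phis n z \<equiv> poly (reversed_poly n (szego_poly \<alpha> n)) z"

text \<open>Comparing products instead of the separate arguments lets unimodular factors move from
  one argument to the other.\<close>

lemma ip_cong:
  assumes "\<And>z. z \<in> space \<mu> \<Longrightarrow> f z * cnj (g z) = f' z * cnj (g' z)"
  shows "ip f g = ip f' g'"
  unfolding ip_def by (rule Bochner_Integration.integral_cong) (use assms in auto)

lemma ip_add_left:
  assumes "continuous_on UNIV f" "continuous_on UNIV f'" "continuous_on UNIV g"
  shows "ip (\<lambda>z. f z + f' z) g = ip f g + ip f' g"
  unfolding ip_def distrib_right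
  by (intro Bochner_Integration.integral_add integrable_continuous continuous_intros assms)

lemma ip_cmult_left: "ip (\<lambda>z. c * f z) g = c * ip f g"
  unfolding ip_def by (simp add: mult.assoc)

lemma ip_cnj: "cnj (ip f g) = ip g f"
  unfolding ip_def by (subst Bochner_Integration.integral_cnj[symmetric]) (simp add: mult.commute)

lemma ip_orthogonal: "m \<noteq> n \<Longrightarrow> ip (phi m) (phi n) = 0"
  using verblunsky by (simp add: has_verblunsky_coeffs_def ip_def)

lemma phi_Suc: "phi (Suc n) z = z * phi n z - cnj (\<alpha> n) * phis n z"
  by (simp add: poly_monom)

lemma phis_eq:
  assumes "z \<in> space \<mu>"
  shows "phis n z = z ^ n * cnj (phi n z)"
proof -
  have "z \<noteq> 0" "inverse (cnj z) = z"
    using cnj_space[OF assms] by (auto simp: inverse_unique mult.commute)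
  then show ?thesis
    using szego_poly_monic[of \<alpha> n] by (simp add: poly_reversed_poly)
qed

text \<open>This is the Szego recursion conjugated and multiplied by \<open>z^(n+1)\<close>, using
  \<open>phis_eq\<close> on the circle.\<close>

lemma phis_Suc:
  assumes "z \<in> space \<mu>"
  shows "phis (Suc n) z = phis n z - \<alpha> n * (z * phi n z)"
proof -
  note z = cnj_space[OF assms]
  have "cnj (phis n z) = cnj z ^ n * phi n z"
    by (simp add: phis_eq[OF assms])
  then have "phis (Suc n) z = (z * cnj z) * (z ^ n * cnj (phi n z))
      - \<alpha> n * ((z * cnj z) ^ n * (z * phi n z))"
    unfolding phis_eq[OF assms, of "Suc n"] phi_Suc
    by (simp add: power_mult_distrib algebra_simps)
  then show ?thesis
    by (simp add: z phis_eq[OF assms])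
qed

text \<open>Subtracting a multiple of the monic orthogonal polynomial of the same degree lowers the
  degree.\<close>

lemma ip_poly_eq_0:
  assumes "p = 0 \<or> degree p < n"
  shows "ip (poly p) (phi n) = 0"
  using assms
proof (induction "degree p" arbitrary: p rule: less_induct)
  case less
  show ?case
  proof (cases "p = 0")
    case True
    then show ?thesis by (simp add: ip_def)
  next
    case False
    with less have d: "degree p < n" by simp
    define q where "q = p - smult (lead_coeff p) (szego_poly \<alpha> (degree p))"
    have m: "degree (szego_poly \<alpha> (degree p)) = degree p" "coeff (szego_poly \<alpha> (degree p)) (degree p) = 1"
      using szego_poly_monic[of \<alpha> "degree p"] by metis+
    have "degree q \<le> degree p"
      unfolding q_def using m(1) by (intro degree_diff_le order_trans[OF degree_smult_le]) auto
    moreover have "coeff q (degree p) = 0"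
      by (simp add: q_def m(2))
    ultimately have "q = 0 \<or> degree q < degree p"
      by (metis leading_coeff_0_iff le_neq_implies_less)
    \<comment> \<open>A constant \<open>p\<close> leaves \<open>q = 0\<close>, whose degree is again
      0. The induction hypothesis does not reach this case, but the integrand vanishes.\<close>
    then have "ip (poly q) (phi n) = 0"
      using less.hyps[of q] d by (auto simp: ip_def)
    moreover have "poly p = (\<lambda>z. lead_coeff p * phi (degree p) z + poly q z)"
      by (auto simp: q_def)
    then have "ip (poly p) (phi n) = ip (\<lambda>z. lead_coeff p * phi (degree p) z + poly q z) (phi n)"
      by simp
    then have "ip (poly p) (phi n) = lead_coeff p * ip (phi (degree p)) (phi n) + ip (poly q) (phi n)"
      by (simp add: ip_add_left ip_cmult_left continuous_intros)
    ultimately show ?thesis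
      using ip_orthogonal[of "degree p" n] d by simp
  qed
qed

section \<open>The recursion for moments, and their gauge weights\<close>

lemma ip_phis_eq_0:
  assumes "s + n < m"
  shows "ip (\<lambda>z. z ^ s * phis n z) (phi m) = 0"
proof -
  have "degree (monom 1 s * reversed_poly n (szego_poly \<alpha> n)) < m"
    using degree_mult_le[of "monom 1 s" "reversed_poly n (szego_poly \<alpha> n)"]
      degree_reversed_poly[of n "szego_poly \<alpha> n"] degree_monom_le[of "1::complex" s] assms
    by linarith
  moreover have "poly (monom 1 s * reversed_poly n (szego_poly \<alpha> n)) = (\<lambda>z. z ^ s * phis n z)"
    by (auto simp: poly_monom)
  ultimately show ?thesis
    using ip_poly_eq_0[of "monom 1 s * reversed_poly n (szego_poly \<alpha> n)" m] by simp
qed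

text \<open>Solving the recursion for \<open>z \<Phi>_n\<close> trades one power of \<open>z\<close>
  for one step up in the index.\<close>

lemma ip_phi_power_Suc:
  "ip (\<lambda>z. z ^ Suc s * phi n z) (phi m)
    = ip (\<lambda>z. z ^ s * phi (Suc n) z) (phi m) + cnj (\<alpha> n) * ip (\<lambda>z. z ^ s * phis n z) (phi m)"
proof -
  have "(\<lambda>z. z ^ Suc s * phi n z) = (\<lambda>z. z ^ s * phi (Suc n) z + cnj (\<alpha> n) * (z ^ s * phis n z))"
    by (rule ext) (simp add: phi_Suc algebra_simps del: szego_poly.simps)
  then show ?thesis
    by (simp only:) (subst ip_add_left,
        auto simp: ip_cmult_left simp del: szego_poly.simps intro!: continuous_intros)
qed

text \<open>Eliminating \<open>z \<Phi>_n\<close> between the two recursions keeps the exponent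
  \<open>s\<close>, so this one can be iterated in the index at fixed \<open>s\<close>.\<close>

lemma ip_phis_Suc:
  "ip (\<lambda>z. z ^ s * phis (Suc n) z) (phi m)
    = (1 - (norm (\<alpha> n))\<^sup>2) * ip (\<lambda>z. z ^ s * phis n z) (phi m)
      - \<alpha> n * ip (\<lambda>z. z ^ s * phi (Suc n) z) (phi m)"
proof -
  have "phis (Suc n) z = (1 - (norm (\<alpha> n))\<^sup>2) * phis n z - \<alpha> n * phi (Suc n) z" if "z \<in> space \<mu>" for z
    by (simp add: phis_Suc[OF that] phi_Suc complex_norm_square algebra_simps
        del: szego_poly.simps of_real_power)
  then have "ip (\<lambda>z. z ^ s * phis (Suc n) z) (phi m)
    = ip (\<lambda>z. (1 - (norm (\<alpha> n))\<^sup>2) * (z ^ s * phis n z) + (- \<alpha> n) * (z ^ s * phi (Suc n) z)) (phi m)"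
    by (intro ip_cong) (simp only:, simp add: algebra_simps del: szego_poly.simps)
  also have "\<dots> = complex_of_real (1 - (norm (\<alpha> n))\<^sup>2) * ip (\<lambda>z. z ^ s * phis n z) (phi m)
      + (- \<alpha> n) * ip (\<lambda>z. z ^ s * phi (Suc n) z) (phi m)"
    unfolding ip_cmult_left[symmetric] by (intro ip_add_left continuous_intros)
  finally show ?thesis by simp
qed

text \<open>On the circle multiplication by \<open>z\<close> is isometric, and
  \<open>\<Phi>_(n+1)\<close> is orthogonal to \<open>\<Phi>_n^*\<close>. Pythagoras gives
  \<open>||\<Phi>_(n+1)||^2 = (1 - |\<alpha>_n|^2) ||\<Phi>_n||^2\<close>, with a nonzero
  factor.\<close>

lemma ip_phi_phi_nonzero: "ip (phi n) (phi n) \<noteq> 0"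
proof (induction n)
  case 0
  then show ?case by (simp add: ip_def prob_space)
next
  case (Suc n)
  have z: "ip (\<lambda>z. z ^ 0 * phis n z) (phi (Suc n)) = 0"
    by (rule ip_phis_eq_0) simp
  let ?S = "\<lambda>z. phi (Suc n) z + cnj (\<alpha> n) * phis n z"
  have "ip (phi n) (phi n) = ip ?S ?S"
  proof (rule ip_cong)
    fix z assume "z \<in> space \<mu>"
    have "?S z = z * phi n z" by (simp add: phi_Suc del: szego_poly.simps)
    then show "phi n z * cnj (phi n z) = ?S z * cnj (?S z)"
      using cnj_space[OF \<open>z \<in> space \<mu>\<close>] by (simp only: complex_cnj_mult mult.assoc mult.left_commute) simp
  qed
  have S: "ip ?S g = ip (phi (Suc n)) g + cnj (\<alpha> n) * ip (phis n) g" if "continuous_on UNIV g" for g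
    using that by (subst ip_add_left) (auto simp: ip_cmult_left simp del: szego_poly.simps intro!: continuous_intros)
  have "ip (phis n) (phis n) = ip (phi n) (phi n)"
  proof (rule ip_cong)
    fix z assume z: "z \<in> space \<mu>"
    have "(z * cnj z) ^ n = 1" by (simp add: cnj_space[OF z])
    then show "phis n z * cnj (phis n z) = phi n z * cnj (phi n z)"
      by (simp add: phis_eq[OF z] power_mult_distrib algebra_simps)
  qed
  moreover have "ip (phi (Suc n)) (phis n) = 0"
    using z ip_cnj[of "phis n" "phi (Suc n)"] by (simp del: szego_poly.simps)
  moreover have "ip ?S (phi (Suc n)) = ip (phi (Suc n)) (phi (Suc n))"
    using S[of "phi (Suc n)"] z by (simp add: continuous_intros del: szego_poly.simps)
  ultimately have "ip (phi n) (phi n)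
      = ip (phi (Suc n)) (phi (Suc n)) + cnj (\<alpha> n) * (\<alpha> n * ip (phi n) (phi n))"
    using S[of ?S] S[of "phis n"] \<open>ip (phi n) (phi n) = ip ?S ?S\<close>
      ip_cnj[of ?S "phi (Suc n)"] ip_cnj[of ?S "phis n"] ip_cnj[of "phi n" "phi n"]
      ip_cnj[of "phi (Suc n)" "phi (Suc n)"]
    by (simp add: continuous_intros del: szego_poly.simps)
  moreover have "(norm (\<alpha> n))\<^sup>2 < 1"
    using verblunsky by (simp add: has_verblunsky_coeffs_def abs_square_less_1)
  then have "\<alpha> n * cnj (\<alpha> n) \<noteq> 1"
    by (metis complex_norm_square less_irrefl of_real_eq_1_iff)
  ultimately show ?case
    using Suc by (metis add_0 mult.assoc mult.commute mult_cancel_right1)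
qed

text \<open>The recursion for \<open>\<Phi>\<^sup>*\<close> is run downwards in the index, where it ends at a vanishing inner
  product because \<open>z\<^sup>s \<Phi>\<^sup>*\<^sub>j\<close> has degree below \<open>j + R\<close>; this is why \<open>s < R\<close> is needed.\<close>

lemma gauge_class_ip:
  assumes k: "k \<ge> 1" and \<alpha>: "\<alpha> = (\<lambda>n. l * cis (2 * pi * \<omega> * real n ^ k))" and "s < R"
  shows "gauge_class k \<omega> 0 (real R - real p - real s)
      (\<lambda>j. ip (\<lambda>z. z ^ s * phi (j + p) z) (phi (j + R)) / ip (phi (j + R)) (phi (j + R)))"
proof -
  define I where "I s p j = ip (\<lambda>z. z ^ s * phi (j + p) z) (phi (j + R)) / ip (phi (j + R)) (phi (j + R))"
    for s p j
  define J where "J s p j = ip (\<lambda>z. z ^ s * phis (j + p) z) (phi (j + R)) / ip (phi (j + R)) (phi (j + R))"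
    for s p j
  have \<alpha>j: "\<alpha> (j + p) = l * cis (2 * pi * \<omega> * real (j + p) ^ k)" for j p
    by (simp add: \<alpha>)
  have I_Suc: "I (Suc s) p = (\<lambda>j. I s (Suc p) j + cnj (\<alpha> (j + p)) * J s p j)" for s p
    unfolding I_def J_def ip_phi_power_Suc by (simp add: add_divide_distrib)
  \<comment> \<open>All coefficients have modulus \<open>norm l\<close>, so the factor
    \<open>1 - |\<alpha>|^2\<close> is a constant and leaves the weights alone.\<close>
  have J_Suc: "J s (Suc p) = (\<lambda>j. (1 - (norm l)\<^sup>2) * J s p j + (- 1) * (\<alpha> (j + p) * I s (Suc p) j))" for s p
  proof
    fix j
    have "norm (\<alpha> (j + p)) = norm l" by (simp add: \<alpha> norm_mult)
    then show "J s (Suc p) j = (1 - (norm l)\<^sup>2) * J s p j + (- 1) * (\<alpha> (j + p) * I s (Suc p) j)"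
      unfolding I_def J_def add_Suc_right ip_phis_Suc
      by (simp add: diff_divide_distrib del: szego_poly.simps)
  qed
  \<comment> \<open>The weight of \<open>J\<close> is independent of \<open>p\<close>: the offset
    \<open>p\<close> contributed by \<open>\<alpha> (j + p)\<close> cancels the \<open>p\<close> in
    the weight of \<open>I s (Suc p)\<close>.\<close>
  have J_step: "\<forall>p. gauge_class k \<omega> 1 (real R - 1 - real s) (J s p)"
    if s: "s < R" and I: "\<And>p. gauge_class k \<omega> 0 (real R - real p - real s) (I s p)" for s
  proof
    fix p
    show "gauge_class k \<omega> 1 (real R - 1 - real s) (J s p)"
    proof (induction p)
      case 0
      have "J s 0 = (\<lambda>j. 0)"
        unfolding J_def using s by (auto simp: ip_phis_eq_0)
      then show ?case by (simp add: gauge_class.zero)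
    next
      case (Suc p)
      have 1: "gauge_class k \<omega> 1 (real R - 1 - real s) (\<lambda>j. c * J s p j)" for c
        using gauge_class_mult_phase[OF _ _ _ Suc, of 0 0 0 c] by simp
      have 2: "gauge_class k \<omega> 1 (real R - 1 - real s) (\<lambda>j. \<alpha> (j + p) * I s (Suc p) j)"
        unfolding \<alpha>j
        using gauge_class_mult_coeff(1)[OF k I[of "Suc p"], of p l] by (simp add: algebra_simps)
      have "gauge_class k \<omega> 1 (real R - 1 - real s) (\<lambda>j. (- 1) * (\<alpha> (j + p) * I s (Suc p) j))"
        using gauge_class_mult_phase[OF _ _ _ 2, of 0 0 0 "- 1"] by simp
      then show ?case
        unfolding J_Suc by (intro gauge_class.add 1)
    qed
  qed
  have "(\<forall>p. gauge_class k \<omega> 0 (real R - real p - real s) (I s p))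
      \<and> (\<forall>p. gauge_class k \<omega> 1 (real R - 1 - real s) (J s p))"
    using \<open>s < R\<close>
  proof (induction s)
    case 0
    have "gauge_class k \<omega> 0 (real R - real p - real 0) (I 0 p)" for p
    proof (cases "p = R")
      case True
      then have "I 0 p = (\<lambda>j. 1)"
        unfolding I_def using ip_phi_phi_nonzero by auto
      then show ?thesis using True by (simp add: gauge_class_const)
    next
      case False
      then have "I 0 p = (\<lambda>j. 0)"
        unfolding I_def by (auto simp: ip_orthogonal)
      then show ?thesis by (simp add: gauge_class.zero)
    qed
    then show ?case using J_step[of 0] 0 by blast
  next
    case (Suc s)
    then have IH: "gauge_class k \<omega> 0 (real R - real p - real s) (I s p)"
      "gauge_class k \<omega> 1 (real R - 1 - real s) (J s p)" for p
      by auto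
    have "gauge_class k \<omega> 0 (real R - real p - real (Suc s)) (I (Suc s) p)" for p
    proof -
      \<comment> \<open>The conjugate coefficient lowers the weights \<open>(1, R - 1 - s)\<close>
        by \<open>(1, p)\<close>, which gives exactly those of \<open>I s (Suc p)\<close>.\<close>
      have "gauge_class k \<omega> 0 (real R - real p - real (Suc s)) (\<lambda>j. cnj (\<alpha> (j + p)) * J s p j)"
        unfolding \<alpha>j
        using gauge_class_mult_coeff(2)[OF k IH(2)[of p], of p l] by (simp add: algebra_simps)
      moreover have "gauge_class k \<omega> 0 (real R - real p - real (Suc s)) (I s (Suc p))"
        using IH(1)[of "Suc p"] by (simp add: algebra_simps)
      ultimately show ?thesis
        unfolding I_Suc by (intro gauge_class.add)
    qed
    then show ?case using J_step[of "Suc s"] Suc.prems by blast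
  qed
  then show ?thesis
    unfolding I_def by blast
qed

lemma ip_power_power:
  assumes "t \<le> s"
  shows "ip (\<lambda>z. z ^ s * f z) (\<lambda>z. z ^ t * g z) = ip (\<lambda>z. z ^ (s - t) * f z) g"
proof (rule ip_cong)
  fix z assume z: "z \<in> space \<mu>"
  have "z ^ s = z ^ (s - t) * z ^ t"
    using assms by (simp flip: power_add)
  moreover have "z ^ t * cnj z ^ t = 1"
    using cnj_space[OF z] by (simp flip: power_mult_distrib)
  ultimately show "z ^ s * f z * cnj (z ^ t * g z) = z ^ (s - t) * f z * cnj (g z)"
    by (simp add: algebra_simps)
qed

text \<open>For \<open>t < s\<close>, cancelling \<open>z^t\<close> and taking \<open>p = R\<close>
  in \<open>gauge_class_ip\<close> leaves the weights 0 and \<open>t - s\<close>, the latter a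
  nonzero integer. Conjugation gives the other case.\<close>

lemma vanishing_mean_moment:
  assumes k: "k \<ge> 2" and \<omega>: "\<omega> \<notin> \<rat>"
    and \<alpha>: "\<alpha> = (\<lambda>n. l * cis (2 * pi * \<omega> * real n ^ k))" and "s < R" "t < R" "s \<noteq> t"
  shows "vanishing_mean (\<lambda>j. ip (\<lambda>z. z ^ s * phi (j + R) z) (\<lambda>z. z ^ t * phi (j + R) z)
    / ip (phi (j + R)) (phi (j + R)))"
proof -
  have *: "vanishing_mean (\<lambda>j. ip (\<lambda>z. z ^ s * phi (j + R) z) (\<lambda>z. z ^ t * phi (j + R) z)
    / ip (phi (j + R)) (phi (j + R)))" if "t < s" "s < R" for s t
  proof -
    have "vanishing_mean (\<lambda>j. ip (\<lambda>z. z ^ (s - t) * phi (j + R) z) (phi (j + R))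
      / ip (phi (j + R)) (phi (j + R)))"
      by (rule gauge_class_vanishing_mean[OF gauge_class_ip[OF _ \<alpha>] k \<omega>]) (use k that in auto)
    then show ?thesis
      using that by (simp add: ip_power_power)
  qed
  show ?thesis
  proof (cases "t < s")
    case False
    then have "vanishing_mean (\<lambda>j. cnj (ip (\<lambda>z. z ^ t * phi (j + R) z) (\<lambda>z. z ^ s * phi (j + R) z)
      / ip (phi (j + R)) (phi (j + R))))"
      using assms by (intro vanishing_mean_cnj *) auto
    then show ?thesis by (simp add: ip_cnj)
  qed (use * assms in auto)
qed

section \<open>The Fejer kernel and the support\<close>

lemma ip_sum_sum:
  assumes "finite A" "\<And>s. s \<in> A \<Longrightarrow> continuous_on UNIV (f s)"
  shows "ip (\<lambda>z. \<Sum>s\<in>A. c s * f s z) (\<lambda>z. \<Sum>t\<in>A. c t * f t z)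
    = (\<Sum>s\<in>A. \<Sum>t\<in>A. c s * cnj (c t) * ip (f s) (f t))"
proof -
  have "ip (\<lambda>z. \<Sum>s\<in>A. c s * f s z) (\<lambda>z. \<Sum>t\<in>A. c t * f t z)
    = (LINT z|\<mu>. (\<Sum>s\<in>A. \<Sum>t\<in>A. c s * cnj (c t) * (f s z * cnj (f t z))))"
    unfolding ip_def by (simp add: sum_product mult_ac)
  also have "\<dots> = (\<Sum>s\<in>A. \<Sum>t\<in>A. LINT z|\<mu>. c s * cnj (c t) * (f s z * cnj (f t z)))"
    by (subst Bochner_Integration.integral_sum,
        intro Bochner_Integration.integrable_sum integrable_continuous continuous_intros assms,
        assumption+, intro sum.cong refl Bochner_Integration.integral_sum integrable_continuous
        continuous_intros assms)
  finally show ?thesis by (simp add: ip_def)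
qed

lemma ip_self: "ip f f = of_real (LINT z|\<mu>. (norm (f z))\<^sup>2)"
  unfolding ip_def by (simp flip: complex_norm_square integral_complex_of_real)

text \<open>The bound on \<open>g\<close> is asked only almost everywhere, because the Fejer sum is
  large near a point that \<mu> is going to ignore.\<close>

lemma ip_self_bound:
  assumes "continuous_on UNIV f" "continuous_on UNIV g"
    and "AE z in \<mu>. (norm (g z))\<^sup>2 \<le> C"
  shows "norm (ip (\<lambda>z. g z * f z) (\<lambda>z. g z * f z)) \<le> C * norm (ip f f)"
proof -
  have int: "integrable \<mu> (\<lambda>z. (norm (h z))\<^sup>2)" if "continuous_on UNIV h" for h
  proof -
    have "integrable \<mu> (\<lambda>z. complex_of_real ((norm (h z))\<^sup>2))"
      using that by (intro integrable_continuous continuous_intros)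
    then show ?thesis by (simp only: complex_of_real_integrable_eq)
  qed
  have "(LINT z|\<mu>. (norm (g z * f z))\<^sup>2) \<le> (LINT z|\<mu>. C * (norm (f z))\<^sup>2)"
  proof (rule integral_mono_AE)
    show "AE z in \<mu>. (norm (g z * f z))\<^sup>2 \<le> C * (norm (f z))\<^sup>2"
      using assms(3) by eventually_elim (simp add: norm_mult power_mult_distrib mult_right_mono)
  qed (use assms in \<open>auto intro!: int Bochner_Integration.integrable_mult_right continuous_intros\<close>)
  then show ?thesis
    unfolding ip_self norm_of_real by simp
qed

text \<open>What matters is that the bound does not depend on \<open>L\<close>.\<close>

lemma norm_geometric_sum_le:
  fixes x :: complex
  assumes "norm x = 1" "norm (x - 1) \<ge> \<delta>" "\<delta> > 0"
  shows "norm (\<Sum>s<L. x ^ s) \<le> 2 / \<delta>"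
proof -
  have "norm (x ^ L - 1) \<le> 2"
    using norm_triangle_ineq4[of "x ^ L" 1] assms by (simp add: norm_power)
  moreover have "x \<noteq> 1" using assms by auto
  ultimately show ?thesis
    using assms by (simp add: geometric_sum norm_divide frac_le)
qed

lemma support_eq_sphere:
  assumes k: "k \<ge> 2" and \<omega>: "\<omega> \<notin> \<rat>"
    and \<alpha>: "\<alpha> = (\<lambda>n. l * cis (2 * pi * \<omega> * real n ^ k))"
  shows "measure_support \<mu> = sphere 0 1"
proof (intro equalityI subsetI)
  fix x assume "x \<in> measure_support \<mu>"
  then have "emeasure \<mu> (- sphere 0 1 \<inter> space \<mu>) \<noteq> 0" if "x \<notin> sphere 0 1"
    using that unfolding measure_support_def by (auto simp: open_Compl)
  then show "x \<in> sphere 0 1" by (auto simp: space_eq)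
next
  fix w :: complex
  assume w: "w \<in> sphere 0 1"
  show "w \<in> measure_support \<mu>"
    unfolding measure_support_def
  proof (intro CollectI allI impI notI)
    fix U :: "complex set"
    assume "open U \<and> w \<in> U" and null: "emeasure \<mu> (U \<inter> space \<mu>) = 0"
    then obtain \<delta> where \<delta>: "\<delta> > 0" "ball w \<delta> \<subseteq> U"
      using open_contains_ball by blast
    \<comment> \<open>\<open>L\<close> will be the limiting mean of \<open>W\<close>, and
      \<open>(2 / \<delta>)^2\<close> a bound for every \<open>W j\<close>.\<close>
    obtain L :: nat where L: "(2 / \<delta>)\<^sup>2 < real L"
      using reals_Archimedean2 by blast
    define g where "g z = (\<Sum>s<L. (cnj w) ^ s * z ^ s)" for z
    define W where "W j = ip (\<lambda>z. g z * phi (j + L) z) (\<lambda>z. g z * phi (j + L) z)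
      / ip (phi (j + L)) (phi (j + L))" for j
    have ww: "w * cnj w = 1"
      using w by (simp add: complex_norm_square[symmetric])
    have "U \<inter> space \<mu> \<in> sets \<mu>"
      using \<open>open U \<and> w \<in> U\<close> unfolding sets_eq space_eq sets_restrict_space by auto
    then have "AE z in \<mu>. z \<notin> U"
      using null by (intro AE_I'[of "U \<inter> space \<mu>"]) auto
    then have "AE z in \<mu>. (norm (g z))\<^sup>2 \<le> (2 / \<delta>)\<^sup>2"
      using AE_space
    proof eventually_elim
      case (elim z)
      \<comment> \<open>Rotating by \<open>cnj w\<close> turns distance to \<open>w\<close> into
        distance to 1, as the geometric sum bound requires.\<close>
      have "cnj w * z - 1 = cnj w * (z - w)"
        using ww by (simp add: algebra_simps)
      then have "norm (cnj w * z - 1) = dist w z"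
        using w by (simp add: norm_mult dist_norm norm_minus_commute)
      also have "\<dots> \<ge> \<delta>"
        using elim \<delta> by (meson linorder_not_le mem_ball subsetD)
      finally have "norm (g z) \<le> 2 / \<delta>"
        unfolding g_def power_mult_distrib[symmetric]
        using \<delta> w norm_space[OF elim(2)] by (intro norm_geometric_sum_le) (auto simp: norm_mult)
      then show ?case by (intro power_mono) auto
    qed
    then have "norm (ip (\<lambda>z. g z * phi n z) (\<lambda>z. g z * phi n z)) \<le> (2 / \<delta>)\<^sup>2 * norm (ip (phi n) (phi n))" for n
      by (intro ip_self_bound) (auto simp: g_def intro!: continuous_intros)
    then have W_bound: "norm (W j) \<le> (2 / \<delta>)\<^sup>2" for j
      using ip_phi_phi_nonzero[of "j + L"] by (simp add: W_def norm_divide divide_le_eq)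
    define m where "m s t j = ip (\<lambda>z. z ^ s * phi (j + L) z) (\<lambda>z. z ^ t * phi (j + L) z)
      / ip (phi (j + L)) (phi (j + L))" for s t j
    have "W j = (\<Sum>s<L. \<Sum>t<L. (cnj w) ^ s * w ^ t * m s t j)" for j
      using ip_sum_sum[of "{..<L}" "\<lambda>s z. z ^ s * phi (j + L) z" "\<lambda>s. (cnj w) ^ s"]
      by (simp add: W_def g_def m_def sum_distrib_right sum_divide_distrib mult.assoc continuous_intros)
    then have "(\<Sum>j<N. W j) = (\<Sum>s<L. \<Sum>t<L. (cnj w) ^ s * w ^ t * (\<Sum>j<N. m s t j))" for N
      by (simp only: sum_distrib_left) (subst sum.swap, rule sum.cong[OF refl], rule sum.swap)
    then have mean: "(\<Sum>j<N. W j) / of_nat N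
        = (\<Sum>s<L. \<Sum>t<L. (cnj w) ^ s * w ^ t * ((\<Sum>j<N. m s t j) / of_nat N))" for N
      by (simp only: sum_divide_distrib[of _ "{..<L}"] times_divide_eq_right)
    \<comment> \<open>Off-diagonal moments average to zero; each of the \<open>L\<close> diagonal
      ones is identically 1.\<close>
    have "(\<lambda>N. (\<Sum>j<N. W j) / of_nat N) \<longlonglongrightarrow> (\<Sum>s<L. \<Sum>t<L. (cnj w) ^ s * w ^ t * (if s = t then 1 else 0))"
      unfolding mean
    proof (intro tendsto_sum tendsto_mult tendsto_const)
      fix s t assume st: "s \<in> {..<L}" "t \<in> {..<L}"
      show "(\<lambda>N. (\<Sum>j<N. m s t j) / of_nat N) \<longlonglongrightarrow> (if s = t then 1 else 0)"
      proof (cases "s = t")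
        case True
        then have "m s t j = 1" for j
          using ip_phi_phi_nonzero by (simp add: m_def ip_power_power)
        \<comment> \<open>The quotient is 0 at \<open>N = 0\<close>, so it equals 1 only
          eventually.\<close>
        moreover have "(\<lambda>N. of_nat N / of_nat N :: complex) \<longlonglongrightarrow> 1"
          by (rule tendsto_eventually) (use eventually_gt_at_top[of 0] in eventually_elim, auto)
        ultimately show ?thesis using True by simp
      next
        case False
        then show ?thesis
          using vanishing_mean_moment[OF k \<omega> \<alpha>, of s L t] st by (simp add: vanishing_mean_def m_def)
      qed
    qed
    also have "(\<Sum>s<L. \<Sum>t<L. (cnj w) ^ s * w ^ t * (if s = t then 1 else 0)) = of_nat L"
    proof -
      have "(cnj w) ^ s * w ^ t * (if s = t then 1 else 0) = (if s = t then 1 else 0)" for s t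
        using ww by (simp add: mult.commute flip: power_mult_distrib)
      then show ?thesis by (simp only:) simp
    qed
    finally have lim: "(\<lambda>N. norm ((\<Sum>j<N. W j) / of_nat N)) \<longlonglongrightarrow> real L"
      using tendsto_norm by fastforce
    have "norm ((\<Sum>j<N. W j) / of_nat N) \<le> (2 / \<delta>)\<^sup>2" for N
    proof (cases "N = 0")
      case False
      have "norm (\<Sum>j<N. W j) \<le> (\<Sum>j<N. (2 / \<delta>)\<^sup>2)"
        by (rule sum_norm_le) (rule W_bound)
      then show ?thesis using False by (simp add: norm_divide divide_le_eq mult.commute)
    qed simp
    then have "real L \<le> (2 / \<delta>)\<^sup>2"
      by (intro LIMSEQ_le_const2[OF lim]) auto
    with L show False by simp
  qed
qed

end

theorem theorem1p1:
  fixes k :: nat and \<omega> :: real and l :: complex and \<mu> :: "complex measure"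
  assumes "k \<ge> 2"
    and "\<omega> \<notin> \<rat>"
    and "0 < norm l" and "norm l < 1"
    and "has_verblunsky_coeffs \<mu>
           (\<lambda>n. l * exp (2 * of_real pi * \<i> * of_real \<omega> * of_nat n ^ k))"
  shows "measure_support \<mu> = sphere 0 1"
proof -
  interpret verblunsky \<mu> "\<lambda>n. l * exp (2 * of_real pi * \<i> * of_real \<omega> * of_nat n ^ k)"
    by unfold_locales (rule assms)
  show ?thesis
    using assms(1,2)
    by (rule support_eq_sphere[of k \<omega> l]) (simp add: cis_conv_exp mult_ac)
qed

end
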